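(* Let $(M^4,J,g,\mathcal{X}^1,\mathcal{X}^2)$ be a geodesically complete toric Kähler 4-manifold with reduction $\Sigma^2=\Phi(M^4)$, and let $q\in\partial\Sigma^2\setminus\Sigma^2$ be a non-included boundary point. If $\{p_i\}\subset M^4$ is any sequence of points with $\Phi(p_i)\to q$ in the coordinate topology of $\mathbb{R}^2$, then $p_i$ diverges in $M^4$ (i.e. every compact subset of $M^4$ contains only finitely many $p_i$).
   Context: $(M^4,J,g)$ is a connected, simply connected Kähler manifold of real dimension 4 with Kähler form $\omega$. $\mathcal{X}^1,\mathcal{X}^2$ are vector fields with $\mathcal{L}_{\mathcal{X}^i}\omega=\mathcal{L}_{\mathcal{X}^i}g=\mathcal{L}_{\mathcal{X}^i}J=0$, $[\mathcal{X}^1,\mathcal{X}^2]=0$, linearly independent at a generic point. Functions $\varphi^1,\varphi^2:M^4\to\mathbb{R}$ satisfy $\omega(\mathcal{X}^i,\cdot)=-d\varphi^i$. The reduction map is $\Phi=(\varphi^1,\varphi^2):M^4\to\mathbb{R}^2$ and $\Sigma^2=\Phi(M^4)$. $\partial\Sigma^2$ is the topological boundary of $\Sigma^2$ in the coordinate plane $\mathbb{R}^2$; points of $\partial\Sigma^2\setminus\Sigma^2$ are "non-included boundary points". *)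

theory Defs
  imports "HOL-Analysis.Analysis"
begin

section \<open>Smooth maps between open subsets of normed spaces\<close>

primrec C_k_on :: "nat \<Rightarrow> ('a::real_normed_vector \<Rightarrow> 'b::real_normed_vector) \<Rightarrow> 'a set \<Rightarrow> bool" where
  "C_k_on 0 f S \<longleftrightarrow> continuous_on S f"
| "C_k_on (Suc k) f S \<longleftrightarrow>
     (\<forall>x\<in>S. f differentiable (at x)) \<and>
     (\<forall>v. C_k_on k (\<lambda>x. frechet_derivative f (at x) v) S)"

text \<open>Only used for open \<open>S\<close>.\<close>

definition smooth_on :: "('a::real_normed_vector \<Rightarrow> 'b::real_normed_vector) \<Rightarrow> 'a set \<Rightarrow> bool" where
  "smooth_on f S \<longleftrightarrow> (\<forall>k. C_k_on k f S)"


section \<open>Smooth manifolds\<close>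

text \<open>The manifold is the whole type \<open>'m\<close>. A chart is its domain together with the coordinate
  map; values of the coordinate map outside the domain are irrelevant.\<close>

type_synonym ('m, 'n) chart = "'m set \<times> ('m \<Rightarrow> real ^ 'n)"

definition chart_inv :: "('m, 'n::finite) chart \<Rightarrow> real ^ 'n \<Rightarrow> 'm" where
  "chart_inv c = inv_into (fst c) (snd c)"

definition is_chart :: "('m::topological_space, 'n::finite) chart \<Rightarrow> bool" where
  "is_chart c \<longleftrightarrow> open (fst c) \<and> open (snd c ` fst c) \<and>
     homeomorphism (fst c) (snd c ` fst c) (snd c) (chart_inv c)"

definition smooth_transition :: "('m, 'n::finite) chart \<Rightarrow> ('m, 'n) chart \<Rightarrow> bool" where
  "smooth_transition c d \<longleftrightarrow> smooth_on (snd d \<circ> chart_inv c) (snd c ` (fst c \<inter> fst d))"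

definition smooth_atlas :: "('m::topological_space, 'n::finite) chart set \<Rightarrow> bool" where
  "smooth_atlas A \<longleftrightarrow> (\<forall>c\<in>A. is_chart c) \<and> (\<Union>c\<in>A. fst c) = UNIV \<and>
     (\<forall>c\<in>A. \<forall>d\<in>A. smooth_transition c d)"

text \<open>The charts of the maximal atlas generated by \<open>A\<close>.\<close>

definition compatible_charts ::
  "('m::topological_space, 'n::finite) chart set \<Rightarrow> ('m, 'n) chart set" where
  "compatible_charts A =
     {c. is_chart c \<and> (\<forall>d\<in>A. smooth_transition c d \<and> smooth_transition d c)}"

definition smooth_fun :: "('m, 'n::finite) chart set \<Rightarrow> ('m \<Rightarrow> real) \<Rightarrow> bool" where
  "smooth_fun A f \<longleftrightarrow> (\<forall>c\<in>A. smooth_on (f \<circ> chart_inv c) (snd c ` fst c))"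


section \<open>Tangent vectors and vector fields\<close>

text \<open>Tangent vectors at \<open>p\<close> are the derivations at \<open>p\<close> of the algebra of smooth functions. They
  are represented as functionals on all functions, with value \<open>0\<close> on the non-smooth ones, so
  that two tangent vectors are equal iff they agree on smooth functions.\<close>

type_synonym 'm tangent = "('m \<Rightarrow> real) \<Rightarrow> real"

definition tangent_space :: "('m, 'n::finite) chart set \<Rightarrow> 'm \<Rightarrow> 'm tangent set" where
  "tangent_space A p = {v.
     (\<forall>f. \<not> smooth_fun A f \<longrightarrow> v f = 0) \<and>
     (\<forall>f h a b. smooth_fun A f \<and> smooth_fun A h \<longrightarrow>
        v (\<lambda>x. a * f x + b * h x) = a * v f + b * v h) \<and>
     (\<forall>f h. smooth_fun A f \<and> smooth_fun A h \<longrightarrow>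
        v (\<lambda>x. f x * h x) = f p * v h + h p * v f)}"

definition lincomb :: "real \<Rightarrow> 'm tangent \<Rightarrow> real \<Rightarrow> 'm tangent \<Rightarrow> 'm tangent" where
  "lincomb a u b v = (\<lambda>f. a * u f + b * v f)"

definition lin_indep2 :: "'m tangent \<Rightarrow> 'm tangent \<Rightarrow> bool" where
  "lin_indep2 u v \<longleftrightarrow> (\<forall>a b. lincomb a u b v = (\<lambda>f. 0) \<longrightarrow> a = 0 \<and> b = 0)"

text \<open>The coordinate vector \<open>\<partial>/\<partial>x\<^sub>i\<close> at the point \<open>p\<close> of the domain of the chart \<open>c\<close>.\<close>

definition coord_vec ::
  "('m, 'n::finite) chart set \<Rightarrow> ('m, 'n) chart \<Rightarrow> 'n \<Rightarrow> 'm \<Rightarrow> 'm tangent" where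
  "coord_vec A c i p = (\<lambda>f. if smooth_fun A f
     then frechet_derivative (f \<circ> chart_inv c) (at (snd c p)) (axis i 1) else 0)"

definition vector_fields :: "('m, 'n::finite) chart set \<Rightarrow> ('m \<Rightarrow> 'm tangent) set" where
  "vector_fields A = {X. (\<forall>p. X p \<in> tangent_space A p) \<and>
     (\<forall>f. smooth_fun A f \<longrightarrow> smooth_fun A (\<lambda>p. X p f))}"

definition lie_bracket :: "('m \<Rightarrow> 'm tangent) \<Rightarrow> ('m \<Rightarrow> 'm tangent) \<Rightarrow> 'm \<Rightarrow> 'm tangent" where
  "lie_bracket X Y = (\<lambda>p f. X p (\<lambda>q. Y q f) - Y p (\<lambda>q. X q f))"


section \<open>Tensor fields\<close>

type_synonym 'm bilin_field = "'m \<Rightarrow> 'm tangent \<Rightarrow> 'm tangent \<Rightarrow> real"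
type_synonym 'm endo_field = "'m \<Rightarrow> 'm tangent \<Rightarrow> 'm tangent"

definition riemannian_metric :: "('m, 'n::finite) chart set \<Rightarrow> 'm bilin_field \<Rightarrow> bool" where
  "riemannian_metric A g \<longleftrightarrow>
     (\<forall>p. \<forall>u\<in>tangent_space A p. \<forall>v\<in>tangent_space A p.
        g p u v = g p v u \<and>
        (\<forall>w\<in>tangent_space A p. \<forall>a b. g p (lincomb a u b v) w = a * g p u w + b * g p v w)) \<and>
     (\<forall>p. \<forall>v\<in>tangent_space A p. v \<noteq> (\<lambda>f. 0) \<longrightarrow> g p v v > 0) \<and>
     (\<forall>X\<in>vector_fields A. \<forall>Y\<in>vector_fields A. smooth_fun A (\<lambda>p. g p (X p) (Y p)))"

definition almost_complex_structure :: "('m, 'n::finite) chart set \<Rightarrow> 'm endo_field \<Rightarrow> bool" where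
  "almost_complex_structure A J \<longleftrightarrow>
     (\<forall>p. \<forall>u\<in>tangent_space A p.
        J p u \<in> tangent_space A p \<and> J p (J p u) = (\<lambda>f. - u f) \<and>
        (\<forall>v\<in>tangent_space A p. \<forall>a b. J p (lincomb a u b v) = lincomb a (J p u) b (J p v))) \<and>
     (\<forall>X\<in>vector_fields A. (\<lambda>p. J p (X p)) \<in> vector_fields A)"

text \<open>Integrability: around every point there are holomorphic coordinates
  \<open>z\<^sub>1 = x\<^sub>1 + \<i> x\<^sub>2\<close>, \<open>z\<^sub>2 = x\<^sub>3 + \<i> x\<^sub>4\<close>.\<close>

definition complex_structure4 :: "('m::topological_space, 4) chart set \<Rightarrow> 'm endo_field \<Rightarrow> bool" where
  "complex_structure4 A J \<longleftrightarrow> almost_complex_structure A J \<and>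
     (\<forall>p. \<exists>c\<in>compatible_charts A. p \<in> fst c \<and>
        (\<forall>q\<in>fst c. J q (coord_vec A c 1 q) = coord_vec A c 2 q \<and>
                   J q (coord_vec A c 3 q) = coord_vec A c 4 q))"

definition kaehler_form :: "'m endo_field \<Rightarrow> 'm bilin_field \<Rightarrow> 'm bilin_field" where
  "kaehler_form J g = (\<lambda>p u v. g p (J p u) v)"

definition closed_2form :: "('m, 'n::finite) chart set \<Rightarrow> 'm bilin_field \<Rightarrow> bool" where
  "closed_2form A \<omega> \<longleftrightarrow>
     (\<forall>X\<in>vector_fields A. \<forall>Y\<in>vector_fields A. \<forall>Z\<in>vector_fields A. \<forall>p.
        X p (\<lambda>q. \<omega> q (Y q) (Z q)) - Y p (\<lambda>q. \<omega> q (X q) (Z q)) + Z p (\<lambda>q. \<omega> q (X q) (Y q))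
        - \<omega> p (lie_bracket X Y p) (Z p) + \<omega> p (lie_bracket X Z p) (Y p)
        - \<omega> p (lie_bracket Y Z p) (X p) = 0)"

definition lie_deriv_bilin ::
  "('m \<Rightarrow> 'm tangent) \<Rightarrow> 'm bilin_field \<Rightarrow> ('m \<Rightarrow> 'm tangent) \<Rightarrow> ('m \<Rightarrow> 'm tangent) \<Rightarrow> 'm \<Rightarrow> real" where
  "lie_deriv_bilin X b Y Z = (\<lambda>p. X p (\<lambda>q. b q (Y q) (Z q))
     - b p (lie_bracket X Y p) (Z p) - b p (Y p) (lie_bracket X Z p))"

definition lie_deriv_endo ::
  "('m \<Rightarrow> 'm tangent) \<Rightarrow> 'm endo_field \<Rightarrow> ('m \<Rightarrow> 'm tangent) \<Rightarrow> 'm \<Rightarrow> 'm tangent" where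
  "lie_deriv_endo X J Y =
     (\<lambda>p f. lie_bracket X (\<lambda>q. J q (Y q)) p f - J p (lie_bracket X Y p) f)"


section \<open>Geodesics\<close>

definition metric_matrix ::
  "('m, 'n::finite) chart set \<Rightarrow> 'm bilin_field \<Rightarrow> ('m, 'n) chart \<Rightarrow> real ^ 'n \<Rightarrow> real ^ 'n ^ 'n" where
  "metric_matrix A g c x = (\<chi> i j. g (chart_inv c x)
     (coord_vec A c i (chart_inv c x)) (coord_vec A c j (chart_inv c x)))"

definition partial_deriv :: "'n::finite \<Rightarrow> (real ^ 'n \<Rightarrow> real) \<Rightarrow> real ^ 'n \<Rightarrow> real" where
  "partial_deriv i h x = frechet_derivative h (at x) (axis i 1)"

text \<open>\<open>\<Gamma>\<^sup>k\<^sub>i\<^sub>j\<close> of the Levi-Civita connection in the chart \<open>c\<close>.\<close>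

definition christoffel ::
  "('m, 'n::finite) chart set \<Rightarrow> 'm bilin_field \<Rightarrow> ('m, 'n) chart \<Rightarrow> 'n \<Rightarrow> 'n \<Rightarrow> 'n \<Rightarrow> real ^ 'n \<Rightarrow> real" where
  "christoffel A g c k i j x = (\<Sum>l\<in>UNIV. matrix_inv (metric_matrix A g c x) $ k $ l *
     (partial_deriv i (\<lambda>y. metric_matrix A g c y $ j $ l) x
      + partial_deriv j (\<lambda>y. metric_matrix A g c y $ i $ l) x
      - partial_deriv l (\<lambda>y. metric_matrix A g c y $ i $ j) x)) / 2"

text \<open>Here \<open>I\<close> is an open interval. Constant curves are geodesics.\<close>

definition geodesic_on ::
  "('m::topological_space, 'n::finite) chart set \<Rightarrow> 'm bilin_field \<Rightarrow> (real \<Rightarrow> 'm) \<Rightarrow> real set \<Rightarrow> bool" where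
  "geodesic_on A g \<gamma> I \<longleftrightarrow> continuous_on I \<gamma> \<and>
     (\<forall>c\<in>A. smooth_on (snd c \<circ> \<gamma>) {t\<in>I. \<gamma> t \<in> fst c} \<and>
       (\<forall>t\<in>I. \<gamma> t \<in> fst c \<longrightarrow> (\<forall>k.
          (let x = snd c \<circ> \<gamma>; x' = (\<lambda>s. vector_derivative x (at s)) in
             vector_derivative x' (at t) $ k
             + (\<Sum>i\<in>UNIV. \<Sum>j\<in>UNIV. christoffel A g c k i j (x t) * x' t $ i * x' t $ j) = 0))))"

text \<open>Every geodesic extends to a geodesic defined on all of \<open>\<real>\<close>.\<close>

definition geodesically_complete ::
  "('m::topological_space, 'n::finite) chart set \<Rightarrow> 'm bilin_field \<Rightarrow> bool" where
  "geodesically_complete A g \<longleftrightarrow>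
     (\<forall>I \<gamma>. open I \<and> is_interval I \<and> I \<noteq> {} \<and> geodesic_on A g \<gamma> I \<longrightarrow>
        (\<exists>\<gamma>'. geodesic_on A g \<gamma>' UNIV \<and> (\<forall>t\<in>I. \<gamma>' t = \<gamma> t)))"


section \<open>Toric Kaehler 4-manifolds\<close>

definition kaehler4 ::
  "('m::{t2_space, second_countable_topology}, 4) chart set \<Rightarrow> 'm endo_field \<Rightarrow> 'm bilin_field \<Rightarrow> bool" where
  "kaehler4 A J g \<longleftrightarrow> smooth_atlas A \<and> complex_structure4 A J \<and> riemannian_metric A g \<and>
     (\<forall>p. \<forall>u\<in>tangent_space A p. \<forall>v\<in>tangent_space A p. g p (J p u) (J p v) = g p u v) \<and>
     closed_2form A (kaehler_form J g)"

definition preserves_kaehler ::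
  "('m, 'n::finite) chart set \<Rightarrow> 'm endo_field \<Rightarrow> 'm bilin_field \<Rightarrow> ('m \<Rightarrow> 'm tangent) \<Rightarrow> bool" where
  "preserves_kaehler A J g X \<longleftrightarrow>
     (\<forall>Y\<in>vector_fields A. \<forall>Z\<in>vector_fields A. \<forall>p.
        lie_deriv_bilin X (kaehler_form J g) Y Z p = 0 \<and> lie_deriv_bilin X g Y Z p = 0) \<and>
     (\<forall>Y\<in>vector_fields A. \<forall>p. lie_deriv_endo X J Y p = (\<lambda>f. 0))"

text \<open>\<open>\<omega>(X, \<cdot>) = - d\<phi>\<close>; here \<open>d\<phi>(v) = v \<phi>\<close>.\<close>

definition momentum_function ::
  "('m, 'n::finite) chart set \<Rightarrow> 'm bilin_field \<Rightarrow> ('m \<Rightarrow> 'm tangent) \<Rightarrow> ('m \<Rightarrow> real) \<Rightarrow> bool" where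
  "momentum_function A \<omega> X \<phi> \<longleftrightarrow> smooth_fun A \<phi> \<and>
     (\<forall>p. \<forall>v\<in>tangent_space A p. \<omega> p (X p) v = - v \<phi>)"

text \<open>``Linearly independent at a generic point'': on an open dense set.\<close>

definition toric_kaehler4 ::
  "('m::{t2_space, second_countable_topology}, 4) chart set \<Rightarrow> 'm endo_field \<Rightarrow> 'm bilin_field \<Rightarrow>
   ('m \<Rightarrow> 'm tangent) \<Rightarrow> ('m \<Rightarrow> 'm tangent) \<Rightarrow> ('m \<Rightarrow> real) \<Rightarrow> ('m \<Rightarrow> real) \<Rightarrow> bool" where
  "toric_kaehler4 A J g X1 X2 \<phi>1 \<phi>2 \<longleftrightarrow>
     kaehler4 A J g \<and> connected (UNIV :: 'm set) \<and> simply_connected (UNIV :: 'm set) \<and>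
     X1 \<in> vector_fields A \<and> X2 \<in> vector_fields A \<and>
     preserves_kaehler A J g X1 \<and> preserves_kaehler A J g X2 \<and>
     (\<forall>p. lie_bracket X1 X2 p = (\<lambda>f. 0)) \<and>
     (\<exists>U. open U \<and> closure U = UNIV \<and> (\<forall>p\<in>U. lin_indep2 (X1 p) (X2 p))) \<and>
     momentum_function A (kaehler_form J g) X1 \<phi>1 \<and>
     momentum_function A (kaehler_form J g) X2 \<phi>2"

definition reduction_map :: "('m \<Rightarrow> real) \<Rightarrow> ('m \<Rightarrow> real) \<Rightarrow> 'm \<Rightarrow> real \<times> real" where
  "reduction_map \<phi>1 \<phi>2 = (\<lambda>p. (\<phi>1 p, \<phi>2 p))"

end

theory Submission
  imports Defs
begin

text \<open>The reduction map \<Phi> is continuous, because its components are smooth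
  (\<open>smooth_fun_continuous\<close>). For compact \<open>K\<close>, the image \<Phi>(K) is then
  compact, hence closed in the plane, and it lies in \<open>\<Sigma>\<close>. As \<open>q\<close> is
  outside \<open>\<Sigma>\<close>, the complement of \<Phi>(K) is an open neighbourhood of
  \<open>q\<close>. It contains \<Phi>(p_i) for all large i, so those p_i avoid \<open>K\<close>
  (\<open>finite_vimage_compact_if_limit_notin_image\<close>).\<close>

text \<open>Smoothness is a condition on the coordinate expressions
  \<open>f \<circ> chart_inv c\<close>, and its order 0 case is their continuity. Composing with the
  chart carries this back to the chart domains, which form an open cover.\<close>

lemma smooth_fun_continuous:
  assumes "smooth_atlas A" and "smooth_fun A f"
  shows "continuous_on UNIV f"
proof -
  have "continuous_on (\<Union>c\<in>A. fst c) f"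
  proof (rule continuous_on_open_UN)
    fix c assume c: "c \<in> A"
    have chart: "is_chart c"
      using assms(1) c by (simp add: smooth_atlas_def)
    then show "open (fst c)"
      by (simp add: is_chart_def)
    from chart have hom: "homeomorphism (fst c) (snd c ` fst c) (snd c) (chart_inv c)"
      by (simp add: is_chart_def)
    have "C_k_on 0 (f \<circ> chart_inv c) (snd c ` fst c)"
      using assms(2) c unfolding smooth_fun_def smooth_on_def by blast
    then have "continuous_on (fst c) ((f \<circ> chart_inv c) \<circ> snd c)"
      using continuous_on_compose[OF homeomorphism_cont1[OF hom]] by simp
    \<comment> \<open>\<open>chart_inv c\<close> undoes \<open>snd c\<close> only on
      \<open>fst c\<close>, so the composite agrees with \<open>f\<close> there and may differ
      elsewhere.\<close>
    then show "continuous_on (fst c) f"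
      by (rule continuous_on_eq) (simp add: homeomorphism_apply1[OF hom])
  qed
  then show ?thesis
    using assms(1) by (simp add: smooth_atlas_def)
qed

lemma finite_vimage_compact_if_limit_notin_image:
  fixes f :: "'a::topological_space \<Rightarrow> 'b::t2_space" and p :: "nat \<Rightarrow> 'a"
  assumes "continuous_on K f" and "compact K"
    and "(\<lambda>i. f (p i)) \<longlonglongrightarrow> q" and "q \<notin> f ` K"
  shows "finite {i. p i \<in> K}"
proof -
  have "open (- f ` K)"
    using assms(1,2) by (simp add: compact_continuous_image compact_imp_closed open_Compl)
  then have "\<forall>\<^sub>F i in sequentially. f (p i) \<in> - f ` K"
    using assms(3,4) by (auto dest: topological_tendstoD)
  \<comment> \<open>On the naturals, holding eventually means failing at only finitely many
    indices.\<close>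
  then have "\<forall>\<^sub>F i in cofinite. p i \<notin> K"
    unfolding cofinite_eq_sequentially by (rule eventually_mono) auto
  then show ?thesis
    by (simp add: eventually_cofinite)
qed

theorem proposition1p3:
  fixes A :: "('m::{t2_space, second_countable_topology}, 4) chart set"
    and J :: "'m endo_field" and g :: "'m bilin_field"
    and X1 X2 :: "'m \<Rightarrow> 'm tangent" and \<phi>1 \<phi>2 :: "'m \<Rightarrow> real"
    and \<Sigma> :: "(real \<times> real) set" and q :: "real \<times> real" and p :: "nat \<Rightarrow> 'm"
  assumes "toric_kaehler4 A J g X1 X2 \<phi>1 \<phi>2"
    and "geodesically_complete A g"
    and "\<Sigma> = range (reduction_map \<phi>1 \<phi>2)"
    and "q \<in> frontier \<Sigma> - \<Sigma>"
    and "(\<lambda>i. reduction_map \<phi>1 \<phi>2 (p i)) \<longlonglongrightarrow> q"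
  shows "\<forall>K. compact K \<longrightarrow> finite {i. p i \<in> K}"
proof (intro allI impI)
  fix K :: "'m set" assume "compact K"
  have "smooth_atlas A" "smooth_fun A \<phi>1" "smooth_fun A \<phi>2"
    using assms(1) by (simp_all add: toric_kaehler4_def kaehler4_def momentum_function_def)
  then have "continuous_on UNIV (reduction_map \<phi>1 \<phi>2)"
    unfolding reduction_map_def by (intro continuous_on_Pair smooth_fun_continuous)
  then have "continuous_on K (reduction_map \<phi>1 \<phi>2)"
    by (rule continuous_on_subset) simp
  \<comment> \<open>The point \<open>q\<close> is a non-included boundary point, so it misses the
    whole range \<open>\<Sigma>\<close>.\<close>
  moreover have "q \<notin> reduction_map \<phi>1 \<phi>2 ` K"
    using assms(3,4) by auto
  ultimately show "finite {i. p i \<in> K}"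
    using \<open>compact K\<close> assms(5) by (intro finite_vimage_compact_if_limit_notin_image)
qed

end
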